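(* Let $f\colon M\to M$ be a homeomorphism of a compact metric space $(M,d)$. Every pseudo-orbit map for $f$ that has self-tuning is an L-shadowing map.
   Context: $\tilde M=M^{\mathbb Z}$; $\sigma\colon\tilde M\to\tilde M$ is the shift, $(\sigma(x))_i=x_{i+1}$; for $p\in M$, $\mathrm{orb}_f(p)\in\tilde M$ is given by $(\mathrm{orb}_f(p))_i=f^i(p)$. Fix $\mu\in(0,1)$ and let $\tilde d_s(x,y)=\sum_{i\in\mathbb Z}\mu^{|i|}d(x_i,y_i)$, a metric inducing the product topology on $\tilde M$. For $\delta\ge 0$, $\tilde M(f,\delta)=\{x\in\tilde M: d(x_{i+1},f(x_i))\le\delta\ \forall i\in\mathbb Z\}$; its elements are called $\delta$-orbits. A pseudo-orbit map for $f$ is a continuous map $\mathrm{Sh}_f\colon\tilde M(f,\delta)\to M$ (for some $\delta>0$) with $\mathrm{Sh}_f(\mathrm{orb}_f(p))=p$ for all $p\in M$. It has self-tuning if for all $\epsilon>0$ there is $\gamma>0$ such that if $\tilde d_s(\sigma^i(x),\mathrm{orb}_f(x_i))<\gamma$ for some $x\in\tilde M(f,\delta)$ and some $i\in\mathbb Z$, then $d(f^i(\mathrm{Sh}_f(x)),\mathrm{Sh}_f(\sigma^i(x)))\le\epsilon$. A sequence $x\in\tilde M$ is a two-sided limit pseudo-orbit if $d(f(x_i),x_{i+1})\to0$ as $|i|\to\infty$. A point $p\in M$ $\epsilon$-shadows $x$ if $d(f^i(p),x_i)\le\epsilon$ for all $i\in\mathbb Z$, and two-sided limit shadows $x$ if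 $d(f^i(p),x_i)\to0$ as $|i|\to\infty$. A pseudo-orbit map is an L-shadowing map if for all $\epsilon>0$ there is $\gamma\in(0,\delta]$ such that for every $\gamma$-orbit $x$ that is also a two-sided limit pseudo-orbit, $\mathrm{Sh}_f(x)$ both $\epsilon$-shadows and two-sided limit shadows $x$. *)

theory Defs
  imports "HOL-Analysis.Analysis"
begin

text \<open>
  The product space of two-sided sequences over \<open>'a\<close> is the type \<open>int \<Rightarrow> 'a\<close>; its topology is
  the product topology of \<^theory>\<open>HOL-Analysis.Function_Topology\<close>.
\<close>

text \<open>Meaningful only for bijective \<open>f\<close>: negative exponents iterate the inverse.\<close>

definition int_iter :: "('a \<Rightarrow> 'a) \<Rightarrow> int \<Rightarrow> 'a \<Rightarrow> 'a" where
  "int_iter f i = (if 0 \<le> i then f ^^ nat i else inv f ^^ nat (- i))"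

definition shift :: "(int \<Rightarrow> 'a) \<Rightarrow> int \<Rightarrow> 'a" where
  "shift x = (\<lambda>i. x (i + 1))"

definition orb :: "('a \<Rightarrow> 'a) \<Rightarrow> 'a \<Rightarrow> int \<Rightarrow> 'a" where
  "orb f p = (\<lambda>i. int_iter f i p)"

text \<open>The sum converges whenever \<open>0 < \<mu> < 1\<close> and the metric is bounded.\<close>

definition seq_dist :: "real \<Rightarrow> (int \<Rightarrow> 'a::metric_space) \<Rightarrow> (int \<Rightarrow> 'a) \<Rightarrow> real" where
  "seq_dist \<mu> x y = (\<Sum>\<^sub>\<infinity>i\<in>UNIV. \<mu> ^ nat \<bar>i\<bar> * dist (x i) (y i))"

definition pseudo_orbits :: "('a::metric_space \<Rightarrow> 'a) \<Rightarrow> real \<Rightarrow> (int \<Rightarrow> 'a) set" where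
  "pseudo_orbits f \<delta> = {x. \<forall>i. dist (x (i + 1)) (f (x i)) \<le> \<delta>}"

text \<open>
  A map with domain \<open>pseudo_orbits f \<delta>\<close> is represented by a total function together with \<open>\<delta>\<close>;
  its values outside that set are irrelevant.
\<close>

definition pseudo_orbit_map ::
  "('a::metric_space \<Rightarrow> 'a) \<Rightarrow> real \<Rightarrow> ((int \<Rightarrow> 'a) \<Rightarrow> 'a) \<Rightarrow> bool" where
  "pseudo_orbit_map f \<delta> Sh \<longleftrightarrow>
     \<delta> > 0 \<and> continuous_on (pseudo_orbits f \<delta>) Sh \<and> (\<forall>p. Sh (orb f p) = p)"

definition self_tuning ::
  "real \<Rightarrow> ('a::metric_space \<Rightarrow> 'a) \<Rightarrow> real \<Rightarrow> ((int \<Rightarrow> 'a) \<Rightarrow> 'a) \<Rightarrow> bool" where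
  "self_tuning \<mu> f \<delta> Sh \<longleftrightarrow>
     (\<forall>\<epsilon>>0. \<exists>\<gamma>>0. \<forall>x\<in>pseudo_orbits f \<delta>. \<forall>i.
        seq_dist \<mu> (int_iter shift i x) (orb f (x i)) < \<gamma> \<longrightarrow>
        dist (int_iter f i (Sh x)) (Sh (int_iter shift i x)) \<le> \<epsilon>)"

abbreviation abs_at_top :: "int filter" where
  "abs_at_top \<equiv> filtercomap abs at_top"

definition two_sided_limit_pseudo_orbit ::
  "('a::metric_space \<Rightarrow> 'a) \<Rightarrow> (int \<Rightarrow> 'a) \<Rightarrow> bool" where
  "two_sided_limit_pseudo_orbit f x \<longleftrightarrow>
     ((\<lambda>i. dist (f (x i)) (x (i + 1))) \<longlongrightarrow> 0) abs_at_top"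

definition shadows ::
  "('a::metric_space \<Rightarrow> 'a) \<Rightarrow> real \<Rightarrow> 'a \<Rightarrow> (int \<Rightarrow> 'a) \<Rightarrow> bool" where
  "shadows f \<epsilon> p x \<longleftrightarrow> (\<forall>i. dist (int_iter f i p) (x i) \<le> \<epsilon>)"

definition two_sided_limit_shadows ::
  "('a::metric_space \<Rightarrow> 'a) \<Rightarrow> 'a \<Rightarrow> (int \<Rightarrow> 'a) \<Rightarrow> bool" where
  "two_sided_limit_shadows f p x \<longleftrightarrow>
     ((\<lambda>i. dist (int_iter f i p) (x i)) \<longlongrightarrow> 0) abs_at_top"

definition L_shadowing_map ::
  "('a::metric_space \<Rightarrow> 'a) \<Rightarrow> real \<Rightarrow> ((int \<Rightarrow> 'a) \<Rightarrow> 'a) \<Rightarrow> bool" where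
  "L_shadowing_map f \<delta> Sh \<longleftrightarrow> pseudo_orbit_map f \<delta> Sh \<and>
     (\<forall>\<epsilon>>0. \<exists>\<gamma>. 0 < \<gamma> \<and> \<gamma> \<le> \<delta> \<and>
        (\<forall>x\<in>pseudo_orbits f \<gamma>. two_sided_limit_pseudo_orbit f x \<longrightarrow>
           shadows f \<epsilon> (Sh x) x \<and> two_sided_limit_shadows f (Sh x) x))"

end

theory Submission
  imports Defs
begin

text \<open>
  Write \<open>K\<close> for the space of \<open>\<delta>\<close>-orbits, a closed subset of a product that is compact by
  Tychonoff's theorem. Let \<open>x \<in> K\<close> and \<open>y = \<sigma>\<^sup>i(x)\<close>, so that \<open>y\<^sub>0 = x\<^sub>i\<close>. The triangle inequality gives
  \<open>d(f\<^sup>i(Sh x), x\<^sub>i) \<le> d(f\<^sup>i(Sh x), Sh y) + d(Sh y, y\<^sub>0)\<close>.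
  Self-tuning controls the first summand as soon as the distance from \<open>y\<close> to the orbit of \<open>y\<^sub>0\<close>
  is small, so shadowing at time \<open>i\<close> depends only on the smallness of two functions of \<open>y\<close>: that
  distance, and \<open>d(Sh y, y\<^sub>0)\<close>. Both are continuous on \<open>K\<close> and both vanish on true orbits, the
  second because \<open>Sh\<close> is a pseudo-orbit map.

  The bridge to the one-step errors \<open>d(y\<^sub>j\<^sub>+\<^sub>1, f(y\<^sub>j))\<close> is a compactness principle: a continuous
  function on \<open>K\<close> that vanishes on true orbits is small at every \<open>y \<in> K\<close> whose errors are small on
  a long enough finite window around \<open>0\<close> (\<open>small_of_small_errors\<close>). Hence, for every \<open>\<epsilon>\<close>, there
  are a window size and an error bound such that \<open>Sh x\<close> is \<open>\<epsilon>\<close>-close to \<open>x\<close> at every time around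
  which the errors of \<open>x\<close> obey the bound (\<open>shadowing_is_local\<close>). When all errors are small, this
  applies at all times and gives shadowing; when the errors tend to zero, it applies at all times of
  large absolute value, for every \<open>\<epsilon>\<close>, and gives limit shadowing.
\<close>

section \<open>Orbits and shifts\<close>

lemma bij_shift: "bij (shift :: (int \<Rightarrow> 'a) \<Rightarrow> _)"
  by (rule bij_betw_byWitness[where f' = "\<lambda>x i. x (i - 1)"]) (auto simp: shift_def)

lemma inv_shift: "inv shift x = (\<lambda>i. x (i - 1))"
  by (rule inv_f_eq) (auto simp: bij_shift bij_is_inj shift_def)

lemma int_iter_shift: "int_iter shift i x = (\<lambda>j. x (j + i))"
proof -
  have "(shift ^^ n) x = (\<lambda>j. x (j + int n))" for n
    by (induction n) (auto simp: shift_def algebra_simps)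
  moreover have "(inv shift ^^ n) x = (\<lambda>j. x (j - int n))" for n
    by (induction n) (auto simp: inv_shift algebra_simps)
  ultimately show ?thesis
    by (auto simp: int_iter_def)
qed

lemma int_iter_shift_pseudo_orbits:
  "x \<in> pseudo_orbits f \<delta> \<Longrightarrow> int_iter shift i x \<in> pseudo_orbits f \<delta>"
  unfolding pseudo_orbits_def int_iter_shift
  by (simp add: add.assoc add.commute[of 1 i]) (simp flip: add.assoc)

lemma eq_orb:
  assumes "bij f" and step: "\<And>j. y (j + 1) = f (y j)"
  shows "y = orb f (y 0)"
proof
  fix i
  have "(f ^^ n) (y 0) = y (int n)" for n
    by (induction n) (auto simp: step[symmetric] algebra_simps)
  moreover have "(inv f ^^ n) (y 0) = y (- int n)" for n
  proof (induction n)
    case (Suc n)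
    have "inv f (y (- int n)) = y (- int n - 1)"
      using step[of "- int n - 1"] \<open>bij f\<close> by (simp add: bij_is_inj)
    moreover have "- int (Suc n) = - int n - 1"
      by simp
    ultimately show ?case
      using Suc by (simp only: funpow.simps o_apply)
  qed simp
  ultimately show "y i = orb f (y 0) i"
    by (auto simp: orb_def int_iter_def)
qed

lemma continuous_on_int_iter:
  fixes f :: "'a::topological_space \<Rightarrow> 'a"
  assumes f: "continuous_on UNIV f" and g: "continuous_on UNIV (inv f)"
  shows "continuous_on UNIV (int_iter f i)"
proof -
  have "continuous_on UNIV (h ^^ n)" if "continuous_on UNIV h" for n and h :: "'a \<Rightarrow> 'a"
  proof (induction n)
    case (Suc n)
    then show ?case
      using continuous_on_compose2[OF that Suc] by (simp add: o_def)
  qed (simp add: id_def)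
  with assms show ?thesis
    by (auto simp: int_iter_def)
qed

section \<open>The space of pseudo-orbits\<close>

lemma compact_UNIV_fun:
  assumes "compact (UNIV :: 'a::topological_space set)"
  shows "compact (UNIV :: ('i \<Rightarrow> 'a) set)"
proof -
  have "compactin (product_topology (\<lambda>i::'i. euclidean :: 'a topology) UNIV) (PiE UNIV (\<lambda>i. UNIV))"
    using assms unfolding compactin_PiE by simp
  then show ?thesis
    by (simp add: euclidean_product_topology)
qed

lemma continuous_on_product_coordinate:
  "continuous_on S (\<lambda>x :: 'i \<Rightarrow> 'a::topological_space. x i)"
  by (rule continuous_on_subset[OF continuous_on_product_coordinates]) simp

lemma closed_error_le:
  fixes f :: "'a::metric_space \<Rightarrow> 'a" and j :: int
  assumes "continuous_on UNIV f"
  shows "closed {y. dist (y (j + 1)) (f (y j)) \<le> c}"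
  by (intro closed_Collect_le continuous_on_dist continuous_on_const
      continuous_on_compose2[OF assms] continuous_on_product_coordinate) auto

lemma closed_pseudo_orbits:
  assumes "continuous_on UNIV f"
  shows "closed (pseudo_orbits f \<delta>)"
proof -
  have "pseudo_orbits f \<delta> = (\<Inter>j. {y. dist (y (j + 1)) (f (y j)) \<le> \<delta>})"
    by (auto simp: pseudo_orbits_def)
  then show ?thesis
    by (simp add: closed_INT closed_error_le[OF assms])
qed

text \<open>
  The \<open>\<delta>\<close>-orbits with \<open>g \<ge> \<epsilon>\<close> whose errors are at most \<open>1 / (n + 1)\<close> on \<open>[-n, n]\<close> form a decreasing
  sequence of compact sets. A common point of all of them would be a true orbit with \<open>g \<ge> \<epsilon>\<close>, so
  one of these sets is already empty.
\<close>

lemma small_of_small_errors: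
  fixes f :: "'a::metric_space \<Rightarrow> 'a" and g :: "(int \<Rightarrow> 'a) \<Rightarrow> real"
  assumes "compact (UNIV :: 'a set)" and f: "continuous_on UNIV f" and "bij f"
    and g: "continuous_on (pseudo_orbits f \<delta>) g"
    and g0: "\<And>p. g (orb f p) = 0"
    and "\<epsilon> > 0"
  shows "\<exists>n. \<forall>y\<in>pseudo_orbits f \<delta>.
    (\<forall>j. \<bar>j\<bar> \<le> int n \<longrightarrow> dist (y (j + 1)) (f (y j)) \<le> 1 / (real n + 1)) \<longrightarrow> g y < \<epsilon>"
proof (rule ccontr)
  let ?K = "pseudo_orbits f \<delta>"
  let ?err = "\<lambda>y j. dist (y (j + 1)) (f (y j))"
  define C where
    "C n = {y\<in>?K. \<epsilon> \<le> g y \<and> (\<forall>j. \<bar>j\<bar> \<le> int n \<longrightarrow> ?err y j \<le> 1 / (real n + 1))}" for n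
  assume "\<not> ?thesis"
  then have nonempty: "C n \<noteq> {}" for n
    unfolding C_def by (fastforce simp: not_less)
  have closed: "closed (C n)" for n
  proof -
    have "C n = (?K \<inter> g -` {\<epsilon>..}) \<inter> (\<Inter>j\<in>{-int n..int n}. {y. ?err y j \<le> 1 / (real n + 1)})"
      by (auto simp: C_def abs_le_iff)
    moreover have "closed (?K \<inter> g -` {\<epsilon>..})"
      by (rule continuous_closed_preimage[OF g closed_pseudo_orbits[OF f]]) simp
    ultimately show ?thesis
      by (simp add: closed_Int closed_INT closed_error_le[OF f])
  qed
  have decseq: "C n \<subseteq> C m" if "m \<le> n" for m n
  proof -
    have "1 / (real n + 1) \<le> 1 / (real m + 1)"
      using that by (simp add: frac_le)
    then show ?thesis
      unfolding C_def using that by (auto intro: order_trans[of _ "1 / (real n + 1)"])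
  qed
  have "UNIV \<inter> (\<Inter>n. C n) \<noteq> {}"
  proof (rule compact_imp_fip_image[OF compact_UNIV_fun[OF assms(1)]])
    fix I :: "nat set"
    assume "finite I"
    then have "C (Max I) \<subseteq> (\<Inter>n\<in>I. C n)"
      by (intro INT_greatest decseq) simp
    then show "UNIV \<inter> (\<Inter>n\<in>I. C n) \<noteq> {}"
      using nonempty[of "Max I"] by auto
  qed (rule closed)
  then obtain y where y: "y \<in> C n" for n
    by auto
  have "?err y j \<le> 0" for j
  proof (rule tendsto_lowerbound)
    show "(\<lambda>n. 1 / (real n + 1)) \<longlonglongrightarrow> 0"
      using LIMSEQ_inverse_real_of_nat by (simp add: inverse_eq_divide add.commute)
    show "\<forall>\<^sub>F n in sequentially. ?err y j \<le> 1 / (real n + 1)"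
      using eventually_ge_at_top[of "nat \<bar>j\<bar>"]
      by eventually_elim (use y in \<open>auto simp: C_def\<close>)
  qed simp
  then have "y = orb f (y 0)"
    by (intro eq_orb[OF \<open>bij f\<close>]) (simp add: dist_le_zero_iff)
  then have "g y = 0"
    using g0[of "y 0"] by simp
  with y[of 0] \<open>\<epsilon> > 0\<close> show False
    by (simp add: C_def)
qed

section \<open>The distance between sequences\<close>

lemma summable_on_power_abs:
  fixes \<mu> :: real
  assumes "0 < \<mu>" "\<mu> < 1"
  shows "(\<lambda>i::int. \<mu> ^ nat \<bar>i\<bar>) summable_on UNIV"
proof -
  have geom: "(\<lambda>n. \<mu> ^ n) summable_on (UNIV :: nat set)"
    using assms by (intro norm_summable_imp_summable_on) (simp add: summable_geometric)
  have "(\<lambda>i::int. \<mu> ^ nat \<bar>i\<bar>) summable_on range int"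
    by (subst summable_on_reindex) (auto simp: o_def geom)
  moreover have "(\<lambda>i::int. \<mu> ^ nat \<bar>i\<bar>) summable_on range (\<lambda>n. - int n)"
    by (subst summable_on_reindex) (auto simp: o_def geom inj_def)
  then have "(\<lambda>i::int. \<mu> ^ nat \<bar>i\<bar>) summable_on (range (\<lambda>n. - int n) - range int)"
    by (rule summable_on_subset_banach) auto
  ultimately have "(\<lambda>i::int. \<mu> ^ nat \<bar>i\<bar>) summable_on (range int \<union> (range (\<lambda>n. - int n) - range int))"
    by (rule summable_on_Un_disjoint) auto
  moreover have "range int \<union> (range (\<lambda>n. - int n) - range int) = UNIV"
  proof -
    have "i \<in> range int \<or> i \<in> range (\<lambda>n. - int n)" for i
      by (cases i rule: int_cases2) auto
    then show ?thesis by blast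
  qed
  ultimately show ?thesis
    by simp
qed

lemma continuous_on_seq_dist:
  fixes u v :: "'b::topological_space \<Rightarrow> int \<Rightarrow> 'a::metric_space"
  assumes "bounded (UNIV :: 'a set)" and "0 < \<mu>" "\<mu> < 1"
    and "continuous_on S u" and "continuous_on S v"
  shows "continuous_on S (\<lambda>y. seq_dist \<mu> (u y) (v y))"
proof -
  obtain D where D: "dist a b \<le> D" for a b :: 'a
    using bounded_two_points[of "UNIV :: 'a set"] assms(1) by auto
  let ?t = "\<lambda>i y. \<mu> ^ nat \<bar>i\<bar> * dist (u y i) (v y i)"
  have "uniform_limit S (\<lambda>I y. \<Sum>i\<in>I. ?t i y) (\<lambda>y. \<Sum>\<^sub>\<infinity>i\<in>UNIV. ?t i y) (finite_subsets_at_top UNIV)"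
  proof (rule Weierstrass_m_test_general)
    show "norm (?t i y) \<le> \<mu> ^ nat \<bar>i\<bar> * D" for i y
      using D assms(2) by (simp add: abs_mult)
    show "(\<lambda>i::int. \<mu> ^ nat \<bar>i\<bar> * D) summable_on UNIV"
      by (intro summable_on_cmult_left summable_on_power_abs assms)
  qed
  then show ?thesis
    unfolding seq_dist_def
  proof (rule uniform_limit_theorem[rotated])
    show "\<forall>\<^sub>F I in finite_subsets_at_top UNIV. continuous_on S (\<lambda>y. \<Sum>i\<in>I. ?t i y)"
      by (intro always_eventually allI continuous_on_sum continuous_on_mult continuous_on_const
          continuous_on_dist continuous_on_product_then_coordinatewise[OF assms(4)]
          continuous_on_product_then_coordinatewise[OF assms(5)])
  qed simp
qed

section \<open>Shadowing\<close>

text \<open>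
  This is the common source of shadowing and limit shadowing: the error bound is required only on
  a window around the time \<open>i\<close>, while the window size and the bound itself depend only on \<open>\<epsilon>\<close>. The
  two halves of \<open>\<epsilon>\<close> are spent on self-tuning and on \<open>d(Sh y, y\<^sub>0)\<close> for the shifted sequence \<open>y\<close>.
\<close>

lemma shadowing_is_local:
  fixes f :: "'a::metric_space \<Rightarrow> 'a"
  assumes M: "compact (UNIV :: 'a set)" and homeo: "homeomorphism UNIV UNIV f (inv f)"
    and \<mu>: "0 < \<mu>" "\<mu> < 1"
    and pom: "pseudo_orbit_map f \<delta> Sh" and tuning: "self_tuning \<mu> f \<delta> Sh"
    and "\<epsilon> > 0"
  shows "\<exists>n. \<exists>\<gamma>>0. \<forall>x\<in>pseudo_orbits f \<delta>. \<forall>i.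
    (\<forall>j. \<bar>j\<bar> \<le> int n \<longrightarrow> dist (x (j + i + 1)) (f (x (j + i))) \<le> \<gamma>) \<longrightarrow>
    dist (int_iter f i (Sh x)) (x i) \<le> \<epsilon>"
proof -
  let ?K = "pseudo_orbits f \<delta>"
  let ?small = "\<lambda>n y. \<forall>j. \<bar>j\<bar> \<le> int n \<longrightarrow> dist (y (j + 1)) (f (y j)) \<le> 1 / (real n + 1)"
  have f: "continuous_on UNIV f" "continuous_on UNIV (inv f)"
    using homeo by (auto simp: homeomorphism_def)
  have "bij f"
    using homeo unfolding homeomorphism_def by (intro bij_betw_byWitness[where f' = "inv f"]) auto
  note small = small_of_small_errors[OF M f(1) \<open>bij f\<close>]
  have Sh: "continuous_on ?K Sh" "\<And>p. Sh (orb f p) = p"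
    using pom by (auto simp: pseudo_orbit_map_def)
  have orb0: "orb f p 0 = p" for p
    by (simp add: orb_def int_iter_def)
  obtain \<eta> where "\<eta> > 0" and \<eta>: "\<And>x i. x \<in> ?K \<Longrightarrow>
      seq_dist \<mu> (int_iter shift i x) (orb f (x i)) < \<eta> \<Longrightarrow>
      dist (int_iter f i (Sh x)) (Sh (int_iter shift i x)) \<le> \<epsilon> / 2"
    using tuning \<open>\<epsilon> > 0\<close> unfolding self_tuning_def by (metis half_gt_zero)
  have "continuous_on ?K (\<lambda>y. orb f (y 0))"
    unfolding orb_def
    by (intro continuous_on_coordinatewise_then_product
        continuous_on_compose2[OF continuous_on_int_iter[OF f]]
        continuous_on_product_coordinate) auto
  then have "continuous_on ?K (\<lambda>y. seq_dist \<mu> y (orb f (y 0)))"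
    by (intro continuous_on_seq_dist compact_imp_bounded M \<mu> continuous_on_id)
  then obtain m where m: "\<And>y. y \<in> ?K \<Longrightarrow> ?small m y \<Longrightarrow> seq_dist \<mu> y (orb f (y 0)) < \<eta>"
    using small[of \<delta> "\<lambda>y. seq_dist \<mu> y (orb f (y 0))" \<eta>] \<open>\<eta> > 0\<close>
    by (auto simp: orb0 seq_dist_def)
  have "continuous_on ?K (\<lambda>y. dist (Sh y) (y 0))"
    by (intro continuous_on_dist Sh continuous_on_product_coordinate)
  then obtain k where k: "\<And>y. y \<in> ?K \<Longrightarrow> ?small k y \<Longrightarrow> dist (Sh y) (y 0) < \<epsilon> / 2"
    using small[of \<delta> "\<lambda>y. dist (Sh y) (y 0)" "\<epsilon> / 2"] \<open>\<epsilon> > 0\<close>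
    by (auto simp: orb0 Sh)
  define n where "n = max m k"
  have small_mono: "?small l y" if "?small n y" "l \<le> n" for l y
  proof -
    have "1 / (real n + 1) \<le> 1 / (real l + 1)"
      using that(2) by (simp add: frac_le)
    with that show ?thesis
      by (meson order_trans of_nat_le_iff)
  qed
  show ?thesis
  proof (intro exI[of _ n] exI[of _ "1 / (real n + 1)"] conjI ballI allI impI)
    fix x i
    assume x: "x \<in> ?K"
      and err: "\<forall>j. \<bar>j\<bar> \<le> int n \<longrightarrow> dist (x (j + i + 1)) (f (x (j + i))) \<le> 1 / (real n + 1)"
    let ?y = "int_iter shift i x"
    have yK: "?y \<in> ?K"
      using x by (rule int_iter_shift_pseudo_orbits)
    have y0: "?y 0 = x i"
      by (simp add: int_iter_shift)
    have y: "?small n ?y"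
      using err by (simp add: int_iter_shift algebra_simps)
    have "seq_dist \<mu> ?y (orb f (?y 0)) < \<eta>"
      by (rule m[OF yK small_mono[OF y]]) (simp add: n_def)
    then have "dist (int_iter f i (Sh x)) (Sh ?y) \<le> \<epsilon> / 2"
      by (intro \<eta> x) (simp add: y0)
    moreover have "dist (Sh ?y) (?y 0) < \<epsilon> / 2"
      by (rule k[OF yK small_mono[OF y]]) (simp add: n_def)
    ultimately show "dist (int_iter f i (Sh x)) (x i) \<le> \<epsilon>"
      using dist_triangle[of "int_iter f i (Sh x)" "x i" "Sh ?y"] unfolding y0 by linarith
  qed simp
qed

theorem proposition5p2:
  fixes f :: "'a::metric_space \<Rightarrow> 'a"
    and Sh :: "(int \<Rightarrow> 'a) \<Rightarrow> 'a"
    and \<mu> \<delta> :: real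
  assumes "compact (UNIV :: 'a set)"
    and "homeomorphism UNIV UNIV f (inv f)"
    and "0 < \<mu>" and "\<mu> < 1"
    and "pseudo_orbit_map f \<delta> Sh"
    and "self_tuning \<mu> f \<delta> Sh"
  shows "L_shadowing_map f \<delta> Sh"
proof -
  note local = shadowing_is_local[OF assms]
  have limit: "two_sided_limit_shadows f (Sh x) x"
    if x: "x \<in> pseudo_orbits f \<delta>" and lim: "two_sided_limit_pseudo_orbit f x" for x
    unfolding two_sided_limit_shadows_def
  proof (rule tendstoI)
    fix e :: real
    assume "e > 0"
    obtain n \<gamma> where "\<gamma> > 0" and n: "\<forall>x\<in>pseudo_orbits f \<delta>. \<forall>i.
        (\<forall>j. \<bar>j\<bar> \<le> int n \<longrightarrow> dist (x (j + i + 1)) (f (x (j + i))) \<le> \<gamma>) \<longrightarrow>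
        dist (int_iter f i (Sh x)) (x i) \<le> e / 2"
      using local[OF half_gt_zero[OF \<open>e > 0\<close>]] by (elim exE conjE) (rule that)
    have "\<forall>\<^sub>F i in abs_at_top. dist (f (x i)) (x (i + 1)) < \<gamma>"
      using lim \<open>\<gamma> > 0\<close> unfolding two_sided_limit_pseudo_orbit_def
      by (auto dest: order_tendstoD(2))
    then obtain N where N: "\<And>i. N \<le> \<bar>i\<bar> \<Longrightarrow> dist (f (x i)) (x (i + 1)) < \<gamma>"
      by (auto simp: eventually_filtercomap eventually_at_top_linorder)
    have "dist (int_iter f i (Sh x)) (x i) < e" if "N + int n \<le> \<bar>i\<bar>" for i
    proof -
      have "dist (int_iter f i (Sh x)) (x i) \<le> e / 2"
      proof (intro n[rule_format, OF x])
        fix j :: int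
        assume "\<bar>j\<bar> \<le> int n"
        then have "N \<le> \<bar>j + i\<bar>"
          using that by linarith
        then show "dist (x (j + i + 1)) (f (x (j + i))) \<le> \<gamma>"
          using N[of "j + i"] by (simp add: dist_commute)
      qed
      with \<open>e > 0\<close> show ?thesis by linarith
    qed
    then show "\<forall>\<^sub>F i in abs_at_top. dist (dist (int_iter f i (Sh x)) (x i)) 0 < e"
      by (auto simp: eventually_filtercomap eventually_at_top_linorder)
  qed
  have "\<exists>\<gamma>. 0 < \<gamma> \<and> \<gamma> \<le> \<delta> \<and> (\<forall>x\<in>pseudo_orbits f \<gamma>. two_sided_limit_pseudo_orbit f x \<longrightarrow>
      shadows f \<epsilon> (Sh x) x \<and> two_sided_limit_shadows f (Sh x) x)" if \<epsilon>: "\<epsilon> > 0" for \<epsilon>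
  proof -
    obtain n \<gamma> where "\<gamma> > 0" and n: "\<forall>x\<in>pseudo_orbits f \<delta>. \<forall>i.
        (\<forall>j. \<bar>j\<bar> \<le> int n \<longrightarrow> dist (x (j + i + 1)) (f (x (j + i))) \<le> \<gamma>) \<longrightarrow>
        dist (int_iter f i (Sh x)) (x i) \<le> \<epsilon>"
      using local[OF \<epsilon>] by (elim exE conjE) (rule that)
    have "shadows f \<epsilon> (Sh x) x \<and> two_sided_limit_shadows f (Sh x) x"
      if x: "x \<in> pseudo_orbits f (min \<gamma> \<delta>)" and lim: "two_sided_limit_pseudo_orbit f x" for x
    proof -
      have x\<delta>: "x \<in> pseudo_orbits f \<delta>" and x\<gamma>: "\<And>i. dist (x (i + 1)) (f (x i)) \<le> \<gamma>"
        using x by (simp_all add: pseudo_orbits_def)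
      have "shadows f \<epsilon> (Sh x) x"
        unfolding shadows_def by (intro allI n[rule_format] x\<delta> x\<gamma>)
      moreover have "two_sided_limit_shadows f (Sh x) x"
        by (rule limit[OF x\<delta> lim])
      ultimately show ?thesis ..
    qed
    moreover have "\<delta> > 0"
      using assms(5) by (simp add: pseudo_orbit_map_def)
    ultimately show ?thesis
      using \<open>\<gamma> > 0\<close> by (intro exI[of _ "min \<gamma> \<delta>"]) auto
  qed
  with assms(5) show ?thesis
    by (simp add: L_shadowing_map_def)
qed

end
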